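(* Let $|N|\geq 4$ and $|O|\geq 3$, and let $f:\mathcal{R}^N\rightarrow\Delta(\mathcal{M})$ be a mechanism. (i) If $f$ satisfies equal treatment of almost equals, strategy-proofness and ex-post weak non-wastefulness, then $f$ is $q$-object-wasteful for some $q\geq \frac{1}{4}$. (ii) If $f$ satisfies equal treatment of equals, strategy-proofness and ex-post efficiency, then $f$ is $q$-object-wasteful for some $q\geq \frac{1}{4}$.
   Context: Model. $N=\{1,\ldots,n\}$ is a finite set of agents and $O$ a finite set of objects. Each agent $i$ has a strict preference $R_i$, a linear order over $O\cup\{i\}$, where $i$ stands for being unassigned; $P_i$ is its asymmetric part. $A(R_i)=\{o\in O: oP_ii\}$ is the set of acceptable objects, and $R_i|O$ is the restriction of $R_i$ to $O$ (the ranking of all objects, acceptable or not). $\mathcal{R}^i$ is the set of all linear orders over $O\cup\{i\}$ and $\mathcal{R}^N=\times_{i\in N}\mathcal{R}^i$ is the set of profiles $R=(R_i)_{i\in N}$. An assignment is a map $\mu$ on $N$ with $\mu_i\in O\cup\{i\}$ for all $i$ and $\mu_i\neq\mu_j$ for $i\neq j$; $\mathcal{M}$ is the set of assignments and $\Delta(\mathcal{M})$ the set of probability distributions over $\mathcal{M}$. A mechanism is a map $f:\mathcal{R}^N\to\Delta(\mathcal{M})$; $f_{ia}(R)$ is the probability that $i$ is assigned $a\in O\cup\{i\}$ under $f(R)$, $f_i(R)=(f_{ia}(R))_{a\in O\cup\{i\}}$, and $f_{oo}(R)=1-\sum_{j\in N}f_{jo}(R)$ for $o\in O$. Properties. An assignment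 $\mu$ is efficient under $R$ if there is no assignment $\mu'$ with $\mu'_iR_i\mu_i$ for all $i$ and $\mu'_jP_j\mu_j$ for some $j$. It is weakly non-wasteful under $R$ if for all $i\in N$ and $x\in O\cup\{i\}$: $xR_i\mu_i$ and $iR_i\mu_i$ together imply that $\mu_j=x$ for some $j\in N$ (i.e. no agent gets an unacceptable object, and no unassigned agent finds acceptable an unassigned object). $f$ is ex-post efficient (resp. ex-post weakly non-wasteful) if for every $R$ every assignment in the support of $f(R)$ is efficient (resp. weakly non-wasteful) under $R$. $f$ is strategy-proof if for all $R$, $i$, $R_i'\in\mathcal{R}^i$ and $x\in O\cup\{i\}$: $\sum_{y:\,yR_ix}f_{iy}(R)\ge\sum_{y:\,yR_ix}f_{iy}(R_i',R_{-i})$. $f$ satisfies equal treatment of equals if for all $R$ and $i,j\in N$, if $R_i=R_j$ (identifying the outside options $i$ and $j$) then $f_{io}(R)=f_{jo}(R)$ for all $o\in O$. $f$ satisfies equal treatment of almost equals if for all $R$ and all $i,j\in N$ with $R_i|O=R_j|O$ and $|A(R_i)|\le|A(R_j)|\le|A(R_i)|+1$, we have $f_{iy}(R)=f_{jy}(R)$ for all $y\in A(R_i)$. Waste. For $q\in[0,1]$, $f$ is $q$-object-wasteful if there exist a profile $R$ and $o\in O$ with $\min\{\sum_{i\in N:\,oP_ii}f_{ii}(R),\,f_{oo}(R)\}\ge q$. *)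

theory Defs
  imports "HOL-Probability.Probability"
begin

text \<open>
  Agents are the elements of a finite type \<open>'i\<close>, objects those of a finite type \<open>'o\<close>.  The set
  \<open>O \<union> {i}\<close> of possible outcomes of agent \<open>i\<close> is rendered as \<open>'o option\<close>: \<open>Some x\<close> is the
  object \<open>x\<close>, and \<open>None\<close> in the role of agent \<open>i\<close> is the outside option \<open>i\<close>.  The outside
  options of different agents are thereby identified, so that \<open>R i = R j\<close> makes sense;
  but they do not compete for \<open>None\<close>.
\<close>

text \<open>\<open>(a, b) \<in> r\<close> reads ``\<open>a\<close> is weakly preferred to \<open>b\<close>'', so the best outcome is the least
  element of the order.\<close>

type_synonym 'o pref = "'o option rel"
type_synonym ('i, 'o) profile = "'i \<Rightarrow> 'o pref"
type_synonym ('i, 'o) assignment = "'i \<Rightarrow> 'o option"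
type_synonym ('i, 'o) mechanism = "('i, 'o) profile \<Rightarrow> ('i, 'o) assignment pmf"

definition is_pref :: "'o pref \<Rightarrow> bool" where
  "is_pref r \<longleftrightarrow> linear_order_on UNIV r"

definition is_profile :: "('i, 'o) profile \<Rightarrow> bool" where
  "is_profile R \<longleftrightarrow> (\<forall>i. is_pref (R i))"

definition strictly_prefers :: "'o pref \<Rightarrow> 'o option \<Rightarrow> 'o option \<Rightarrow> bool" where
  "strictly_prefers r a b \<longleftrightarrow> (a, b) \<in> r \<and> (b, a) \<notin> r"

definition acceptable :: "'o pref \<Rightarrow> 'o set" where
  "acceptable r = {x. strictly_prefers r (Some x) None}"

definition restrict_objects :: "'o pref \<Rightarrow> 'o rel" where
  "restrict_objects r = {(x, y). (Some x, Some y) \<in> r}"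

definition is_assignment :: "('i, 'o) assignment \<Rightarrow> bool" where
  "is_assignment \<mu> \<longleftrightarrow> (\<forall>i j. i \<noteq> j \<longrightarrow> \<mu> i \<noteq> None \<longrightarrow> \<mu> i \<noteq> \<mu> j)"

text \<open>Only the values at profiles matter; a mechanism is arbitrary on non-profiles.\<close>

definition is_mechanism :: "('i, 'o) mechanism \<Rightarrow> bool" where
  "is_mechanism f \<longleftrightarrow> (\<forall>R. is_profile R \<longrightarrow> (\<forall>\<mu> \<in> set_pmf (f R). is_assignment \<mu>))"

definition assign_prob :: "('i, 'o) mechanism \<Rightarrow> ('i, 'o) profile \<Rightarrow> 'i \<Rightarrow> 'o option \<Rightarrow> real" where
  "assign_prob f R i a = measure_pmf.prob (f R) {\<mu>. \<mu> i = a}"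

definition unassigned_prob :: "('i::finite, 'o) mechanism \<Rightarrow> ('i, 'o) profile \<Rightarrow> 'o \<Rightarrow> real" where
  "unassigned_prob f R x = 1 - (\<Sum>j\<in>UNIV. assign_prob f R j (Some x))"

definition efficient :: "('i, 'o) profile \<Rightarrow> ('i, 'o) assignment \<Rightarrow> bool" where
  "efficient R \<mu> \<longleftrightarrow>
     \<not> (\<exists>\<mu>'. is_assignment \<mu>' \<and> (\<forall>i. (\<mu>' i, \<mu> i) \<in> R i) \<and>
            (\<exists>j. strictly_prefers (R j) (\<mu>' j) (\<mu> j)))"

text \<open>Whether somebody receives the outcome \<open>x\<close> of agent \<open>i\<close>: agent \<open>i\<close>'s outside option can
  only be received by \<open>i\<close> itself, whereas \<open>\<mu> j = None\<close> refers to the outside option of \<open>j\<close>.\<close>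

definition outcome_taken :: "('i, 'o) assignment \<Rightarrow> 'i \<Rightarrow> 'o option \<Rightarrow> bool" where
  "outcome_taken \<mu> i x \<longleftrightarrow> (\<exists>j. \<mu> j = x \<and> (x = None \<longrightarrow> j = i))"

definition weakly_nonwasteful :: "('i, 'o) profile \<Rightarrow> ('i, 'o) assignment \<Rightarrow> bool" where
  "weakly_nonwasteful R \<mu> \<longleftrightarrow>
     (\<forall>i x. (x, \<mu> i) \<in> R i \<and> (None, \<mu> i) \<in> R i \<longrightarrow> outcome_taken \<mu> i x)"

definition ex_post_efficient :: "('i, 'o) mechanism \<Rightarrow> bool" where
  "ex_post_efficient f \<longleftrightarrow> (\<forall>R. is_profile R \<longrightarrow> (\<forall>\<mu> \<in> set_pmf (f R). efficient R \<mu>))"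

definition ex_post_weakly_nonwasteful :: "('i, 'o) mechanism \<Rightarrow> bool" where
  "ex_post_weakly_nonwasteful f \<longleftrightarrow>
     (\<forall>R. is_profile R \<longrightarrow> (\<forall>\<mu> \<in> set_pmf (f R). weakly_nonwasteful R \<mu>))"

definition strategy_proof :: "('i, 'o::finite) mechanism \<Rightarrow> bool" where
  "strategy_proof f \<longleftrightarrow>
     (\<forall>R i r' x. is_profile R \<and> is_pref r' \<longrightarrow>
        (\<Sum>y | (y, x) \<in> R i. assign_prob f R i y)
          \<ge> (\<Sum>y | (y, x) \<in> R i. assign_prob f (R(i := r')) i y))"

definition equal_treatment_of_equals :: "('i, 'o) mechanism \<Rightarrow> bool" where
  "equal_treatment_of_equals f \<longleftrightarrow>
     (\<forall>R i j. is_profile R \<and> R i = R j \<longrightarrow>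
        (\<forall>x. assign_prob f R i (Some x) = assign_prob f R j (Some x)))"

definition equal_treatment_of_almost_equals :: "('i, 'o) mechanism \<Rightarrow> bool" where
  "equal_treatment_of_almost_equals f \<longleftrightarrow>
     (\<forall>R i j. is_profile R \<and> restrict_objects (R i) = restrict_objects (R j) \<and>
        card (acceptable (R i)) \<le> card (acceptable (R j)) \<and>
        card (acceptable (R j)) \<le> card (acceptable (R i)) + 1 \<longrightarrow>
        (\<forall>y \<in> acceptable (R i). assign_prob f R i (Some y) = assign_prob f R j (Some y)))"

definition object_wasteful :: "real \<Rightarrow> ('i::finite, 'o) mechanism \<Rightarrow> bool" where
  "object_wasteful q f \<longleftrightarrow>
     (\<exists>R x. is_profile R \<and>
        min (\<Sum>i | strictly_prefers (R i) (Some x) None. assign_prob f R i None)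
            (unassigned_prob f R x) \<ge> q)"

end

theory Submission
  imports Defs
begin

text \<open>
  Both parts reduce to equal treatment of equals, strategy-proofness and ex-post weak
  non-wastefulness.  Under these, the waste of \<open>c\<close> is exactly \<open>1/4\<close> at the profile where agents
  \<open>i, j, k, l\<close> accept \<open>a c\<close>, \<open>b c\<close>, \<open>a\<close>, \<open>b\<close> (best first), and nobody else accepts anything.
  There \<open>i\<close> and \<open>k\<close> get \<open>a\<close> with probability \<open>1/2\<close> each, and \<open>j\<close> and \<open>l\<close> get \<open>b\<close> with
  probability \<open>1/2\<close> each, so the claim is that \<open>i\<close> and \<open>j\<close> together get \<open>c\<close> with probability \<open>3/4\<close>.
  Let \<open>i\<close> report \<open>a c\<close> or \<open>c\<close>, \<open>j\<close> report \<open>b c\<close> or \<open>c\<close>, \<open>k\<close> report \<open>a\<close> or \<open>a c\<close>, and \<open>l\<close>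
  report \<open>b\<close> or \<open>b c\<close>.  At each of these 16 profiles except the one in question \<open>c\<close> is certainly
  assigned, and strategy-proofness gives the exchange identities \<open>P_c_exchange\<close> between them; the
  resulting linear system determines the value \<open>3/4\<close>.
\<close>

section \<open>Preferences built from lists of acceptable objects\<close>

definition to_top :: "'o option \<Rightarrow> 'o pref \<Rightarrow> 'o pref" where
  "to_top x r = {(y, z). y = x \<or> (z \<noteq> x \<and> (y, z) \<in> r)}"

lemma mem_to_top: "(y, z) \<in> to_top x r \<longleftrightarrow> y = x \<or> (z \<noteq> x \<and> (y, z) \<in> r)"
  by (simp add: to_top_def)

lemma is_pref_to_top:
  assumes "is_pref r"
  shows "is_pref (to_top x r)"
proof -
  have "refl r" "trans r" "antisym r" "total r"
    using assms by (auto simp: is_pref_def order_on_defs)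
  then have "refl (to_top x r)" "trans (to_top x r)" "antisym (to_top x r)" "total (to_top x r)"
    unfolding refl_on_def trans_def antisym_def total_on_def mem_to_top by (blast | metis)+
  then show ?thesis
    by (simp add: is_pref_def order_on_defs)
qed

lemma is_pref_refl: "is_pref r \<Longrightarrow> (x, x) \<in> r"
  by (auto simp: is_pref_def order_on_defs refl_on_def)

lemma ex_is_pref: "\<exists>r :: 'o pref. is_pref r"
  using well_order_on[of "UNIV :: 'o option set"] by (auto simp: is_pref_def well_order_on_def)

text \<open>What lies below \<open>None\<close> comes from one fixed arbitrary order, so equal lists
  give equal preferences and equal treatment applies.\<close>

fun ranking :: "'o list \<Rightarrow> 'o pref" where
  "ranking [] = to_top None (SOME r. is_pref r)"
| "ranking (x # xs) = to_top (Some x) (ranking xs)"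

lemma is_pref_ranking: "is_pref (ranking xs)"
  by (induction xs) (simp_all add: is_pref_to_top someI_ex[OF ex_is_pref])

lemma strictly_prefers_ranking_None:
  "strictly_prefers (ranking xs) (Some x) None \<longleftrightarrow> x \<in> set xs"
  by (induction xs) (auto simp: strictly_prefers_def mem_to_top)

lemma ranking_None_preferred: "x \<notin> set xs \<Longrightarrow> (None, Some x) \<in> ranking xs"
  by (induction xs) (auto simp: mem_to_top)

lemma ranking_above_None: "x \<in> set xs \<Longrightarrow> (Some x, None) \<in> ranking xs"
  using strictly_prefers_ranking_None by (fastforce simp: strictly_prefers_def)

definition ranked :: "('i \<Rightarrow> 'o list) \<Rightarrow> ('i, 'o) profile" where
  "ranked L = (\<lambda>m. ranking (L m))"

lemma is_profile_ranked: "is_profile (ranked L)"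
  by (simp add: is_profile_def ranked_def is_pref_ranking)

lemma ranked_upd: "(ranked L)(m := ranking xs) = ranked (L(m := xs))"
  by (rule ext) (simp add: ranked_def)

lemma upper_set_first: "{y. (y, x) \<in> to_top x r} = {x}"
  by (auto simp: mem_to_top)

lemma upper_set_second:
  assumes "is_pref r"
  shows "{z. (z, y) \<in> to_top x (to_top y r)} = {x, y}"
  using is_pref_refl[OF assms] by (auto simp: mem_to_top)

section \<open>Sums of assignment probabilities\<close>

lemma sum_assign_prob:
  fixes f :: "('i, 'o::finite) mechanism"
  shows "(\<Sum>x\<in>UNIV. assign_prob f R m x) = 1"
proof -
  have "(\<Sum>x\<in>UNIV. assign_prob f R m x)
      = measure_pmf.prob (f R) (\<Union>x\<in>UNIV. {\<mu>. \<mu> m = x})"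
    unfolding assign_prob_def
    by (rule measure_pmf.finite_measure_finite_Union[symmetric]) (auto simp: disjoint_family_on_def)
  also have "(\<Union>x\<in>UNIV. {\<mu>. \<mu> m = x}) = UNIV" by auto
  finally show ?thesis by simp
qed

lemma assign_prob_nonneg: "assign_prob f R m x \<ge> 0"
  by (simp add: assign_prob_def)

lemma assign_prob_eq_0:
  assumes "\<And>\<mu>. \<mu> \<in> set_pmf (f R) \<Longrightarrow> \<mu> m \<noteq> x"
  shows "assign_prob f R m x = 0"
  using assms by (auto simp: assign_prob_def measure_pmf_zero_iff)

lemma sum_assign_prob_taken:
  fixes f :: "('i::finite, 'o) mechanism"
  assumes "is_mechanism f" "is_profile R"
    and taken: "\<And>\<mu>. \<mu> \<in> set_pmf (f R) \<Longrightarrow> \<exists>m. \<mu> m = Some x"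
  shows "(\<Sum>m\<in>UNIV. assign_prob f R m (Some x)) = 1"
proof -
  have asg: "is_assignment \<mu>" if "\<mu> \<in> set_pmf (f R)" for \<mu>
    using assms that by (auto simp: is_mechanism_def)
  \<comment> \<open>The events are disjoint only among assignments, so they are first cut down to
    the support.\<close>
  have "assign_prob f R m (Some x) = measure_pmf.prob (f R) {\<mu> \<in> set_pmf (f R). \<mu> m = Some x}" for m
    unfolding assign_prob_def by (rule measure_prob_cong_0) (auto simp: set_pmf_iff)
  then have "(\<Sum>m\<in>UNIV. assign_prob f R m (Some x))
      = (\<Sum>m\<in>UNIV. measure_pmf.prob (f R) {\<mu> \<in> set_pmf (f R). \<mu> m = Some x})"
    by simp
  also have "\<dots> = measure_pmf.prob (f R) (\<Union>m\<in>UNIV. {\<mu> \<in> set_pmf (f R). \<mu> m = Some x})"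
    using asg
    by (intro measure_pmf.finite_measure_finite_Union[symmetric])
      (auto simp: disjoint_family_on_def is_assignment_def, metis)
  also have "(\<Union>m\<in>UNIV. {\<mu> \<in> set_pmf (f R). \<mu> m = Some x}) = set_pmf (f R)"
    using taken by auto
  finally show ?thesis by (simp add: measure_pmf.prob_eq_1 AE_measure_pmf)
qed

section \<open>Reduction of both claims to common axioms\<close>

lemma efficient_imp_weakly_nonwasteful:
  assumes "efficient R \<mu>" "is_profile R" "is_assignment \<mu>"
  shows "weakly_nonwasteful R \<mu>"
  unfolding weakly_nonwasteful_def
proof (intro allI impI)
  fix i x
  assume pref: "(x, \<mu> i) \<in> R i \<and> (None, \<mu> i) \<in> R i"
  show "outcome_taken \<mu> i x"
  proof (rule ccontr)
    assume free: "\<not> outcome_taken \<mu> i x"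
    have refl: "(y, y) \<in> R j" for j y
      using assms(2) is_pref_refl by (auto simp: is_profile_def)
    \<comment> \<open>Moving \<open>i\<close> alone to the free outcome \<open>x\<close> is a Pareto
      improvement; it is strict because \<open>\<mu> i\<close> is taken by \<open>i\<close>, hence
      differs from \<open>x\<close>.\<close>
    have "antisym (R i)"
      using assms(2) by (auto simp: is_profile_def is_pref_def order_on_defs)
    then have "strictly_prefers (R i) x (\<mu> i)"
      using pref free by (auto simp: strictly_prefers_def outcome_taken_def antisym_def)
    moreover have "is_assignment (\<mu>(i := x))"
      using assms(3) free unfolding is_assignment_def outcome_taken_def by auto
    ultimately show False
      using assms(1) pref refl unfolding efficient_def
      by (metis fun_upd_other fun_upd_same)
  qed
qed

lemma equal_treatment_of_equals_if_almost_equals: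
  fixes f :: "('i, 'o) mechanism"
  assumes "equal_treatment_of_almost_equals f" "ex_post_weakly_nonwasteful f"
  shows "equal_treatment_of_equals f"
  unfolding equal_treatment_of_equals_def
proof (intro allI impI)
  fix R :: "('i, 'o) profile" and i j x
  assume R: "is_profile R \<and> R i = R j"
  show "assign_prob f R i (Some x) = assign_prob f R j (Some x)"
  proof (cases "x \<in> acceptable (R i)")
    case True
    then show ?thesis
      using assms(1) R unfolding equal_treatment_of_almost_equals_def by (metis le_add1 order_refl)
  next
    case False
    \<comment> \<open>Stated for every \<open>m\<close> with this preference, to cover
      \<open>i\<close> and \<open>j\<close>. An unacceptable object would leave \<open>m\<close>'s
      own outside option weakly preferred but not taken.\<close>
    have "\<mu> m \<noteq> Some x" if \<mu>: "\<mu> \<in> set_pmf (f R)" and m: "R m = R i" for \<mu> m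
    proof
      assume eq: "\<mu> m = Some x"
      have "total (R m)"
        using R by (auto simp: is_profile_def is_pref_def order_on_defs)
      then have "(None, \<mu> m) \<in> R m"
        using False m eq by (auto simp: acceptable_def strictly_prefers_def total_on_def)
      moreover have "weakly_nonwasteful R \<mu>"
        using assms(2) R \<mu> by (auto simp: ex_post_weakly_nonwasteful_def)
      moreover have "(None, None) \<in> R m"
        using R is_pref_refl by (auto simp: is_profile_def)
      ultimately show False
        using eq unfolding weakly_nonwasteful_def outcome_taken_def
        by (metis R is_pref_refl is_profile_def option.distinct(1))
    qed
    then show ?thesis using R by (metis assign_prob_eq_0)
  qed
qed

section \<open>Consequences of the axioms at profiles given by lists\<close>

locale fair_mechanism =
  fixes f :: "('i::finite, 'o::finite) mechanism"
  assumes mech: "is_mechanism f"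
    and ete: "equal_treatment_of_equals f"
    and sp: "strategy_proof f"
    and wnw: "ex_post_weakly_nonwasteful f"
begin

abbreviation prob :: "('i \<Rightarrow> 'o list) \<Rightarrow> 'i \<Rightarrow> 'o \<Rightarrow> real" where
  "prob L m x \<equiv> assign_prob f (ranked L) m (Some x)"

lemma prob_equals: "L m = L n \<Longrightarrow> prob L m x = prob L n x"
  using ete[unfolded equal_treatment_of_equals_def, rule_format, of "ranked L" m n]
    is_profile_ranked[of L] by (simp add: ranked_def)

lemma sp_ranked:
  "(\<Sum>y | (y, x) \<in> ranking xs. assign_prob f (ranked (L(m := xs))) m y)
     \<ge> (\<Sum>y | (y, x) \<in> ranking xs. assign_prob f (ranked (L(m := ys))) m y)"
proof -
  have "ranked (L(m := xs)) m = ranking xs" by (simp add: ranked_def)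
  then show ?thesis
    using sp[unfolded strategy_proof_def, rule_format, of "ranked (L(m := xs))" "ranking ys" m x]
    by (simp add: is_profile_ranked is_pref_ranking ranked_upd)
qed

text \<open>Both reports have the upper set \<open>{Some x}\<close>, so strategy-proofness bounds
  the probability in both directions.\<close>

lemma prob_first: "prob (L(m := x # xs)) m x = prob (L(m := x # ys)) m x"
proof -
  have "prob (L(m := x # xs)) m x \<ge> prob (L(m := x # ys)) m x" for xs ys
    using sp_ranked[where x = "Some x" and xs = "x # xs" and ys = "x # ys" and L = L and m = m]
    by (simp add: upper_set_first)
  then show ?thesis by (meson order_antisym)
qed

text \<open>The same argument with the common upper set \<open>{Some x, Some y}\<close>.\<close>

lemma prob_first_two:
  assumes "x \<noteq> y"
  shows "prob (L(m := x # y # xs)) m x + prob (L(m := x # y # xs)) m y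
       = prob (L(m := y # x # ys)) m x + prob (L(m := y # x # ys)) m y"
proof -
  have "prob (L(m := x # y # xs)) m x + prob (L(m := x # y # xs)) m y
       \<ge> prob (L(m := y # x # ys)) m x + prob (L(m := y # x # ys)) m y"
    if "x \<noteq> y" for xs ys and x y :: 'o
    using sp_ranked[where x = "Some y" and xs = "x # y # xs" and ys = "y # x # ys" and L = L and m = m]
      is_pref_ranking[of xs] that by (simp add: upper_set_second)
  from this[of x y ys xs] this[of y x xs ys] assms show ?thesis by (simp add: add.commute)
qed

context
  fixes L :: "'i \<Rightarrow> 'o list" and \<mu>
  assumes \<mu>: "\<mu> \<in> set_pmf (f (ranked L))"
begin

lemma assigned_acceptable:
  assumes "\<mu> m = Some x"
  shows "x \<in> set (L m)"
proof (rule ccontr)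
  assume "x \<notin> set (L m)"
  then have "(None, \<mu> m) \<in> ranked L m"
    using assms by (simp add: ranked_def ranking_None_preferred)
  moreover have "weakly_nonwasteful (ranked L) \<mu>"
    using wnw \<mu> by (auto simp: ex_post_weakly_nonwasteful_def is_profile_ranked)
  ultimately show False
    using assms unfolding weakly_nonwasteful_def outcome_taken_def by (metis option.distinct(1))
qed

lemma unassigned_imp_taken:
  assumes "\<mu> m = None" "x \<in> set (L m)"
  shows "\<exists>n. \<mu> n = Some x"
proof -
  have "(Some x, \<mu> m) \<in> ranked L m" "(None, \<mu> m) \<in> ranked L m"
    using assms by (auto simp: ranked_def ranking_above_None is_pref_refl[OF is_pref_ranking])
  moreover have "weakly_nonwasteful (ranked L) \<mu>"
    using wnw \<mu> by (auto simp: ex_post_weakly_nonwasteful_def is_profile_ranked)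
  ultimately show ?thesis
    unfolding weakly_nonwasteful_def outcome_taken_def by blast
qed

end

lemma prob_unacceptable: "x \<notin> set (L m) \<Longrightarrow> prob L m x = 0"
  using assigned_acceptable by (metis assign_prob_eq_0)

text \<open>Agent \<open>m\<close> either gets \<open>x\<close> or is unassigned, and then weak
  non-wastefulness has \<open>x\<close> taken.\<close>

lemma sum_prob_single:
  assumes "set (L m) = {x}"
  shows "(\<Sum>n\<in>UNIV. prob L n x) = 1"
proof (rule sum_assign_prob_taken[OF mech is_profile_ranked])
  fix \<mu> assume \<mu>: "\<mu> \<in> set_pmf (f (ranked L))"
  show "\<exists>n. \<mu> n = Some x"
    using assigned_acceptable[OF \<mu>] unassigned_imp_taken[OF \<mu>] assms
    by (metis insertI1 option.exhaust singletonD)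
qed

text \<open>If \<open>x\<close> were free, neither agent could be unassigned, so both would hold
  \<open>y\<close>.\<close>

lemma sum_prob_pair:
  assumes "m \<noteq> n" "set (L m) = {x, y}" "set (L n) = {x, y}"
  shows "(\<Sum>n\<in>UNIV. prob L n x) = 1"
proof (rule sum_assign_prob_taken[OF mech is_profile_ranked])
  fix \<mu> assume \<mu>: "\<mu> \<in> set_pmf (f (ranked L))"
  show "\<exists>n. \<mu> n = Some x"
  proof (rule ccontr)
    assume untaken: "\<nexists>n. \<mu> n = Some x"
    have "\<mu> k = Some y" if "set (L k) = {x, y}" for k
      using assigned_acceptable[OF \<mu>, of k] unassigned_imp_taken[OF \<mu>, of k x] that untaken
      by (cases "\<mu> k") auto
    then have "\<mu> m = Some y" "\<mu> n = Some y" using assms by auto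
    moreover have "is_assignment \<mu>"
      using mech \<mu> is_profile_ranked unfolding is_mechanism_def by blast
    ultimately show False
      using \<open>m \<noteq> n\<close> unfolding is_assignment_def by (metis option.distinct(1))
  qed
qed

lemma prob_acceptable_two:
  assumes "set (L m) = {x, y}" "x \<noteq> y"
  shows "prob L m x + prob L m y + assign_prob f (ranked L) m None = 1"
proof -
  have zero: "assign_prob f (ranked L) m z = 0" if "z \<notin> {Some x, Some y, None}" for z
    using that assms by (cases z) (auto intro: prob_unacceptable)
  have "(\<Sum>z\<in>UNIV. assign_prob f (ranked L) m z)
      = (\<Sum>z\<in>{Some x, Some y, None}. assign_prob f (ranked L) m z)"
    using zero by (intro sum.mono_neutral_right) auto
  then show ?thesis using assms by (simp add: sum_assign_prob)
qed

end

section \<open>Four agents and three objects\<close>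

definition quad ::
    "'i \<Rightarrow> 'i \<Rightarrow> 'i \<Rightarrow> 'i \<Rightarrow> 'o list \<Rightarrow> 'o list \<Rightarrow> 'o list \<Rightarrow> 'o list \<Rightarrow> 'i \<Rightarrow> 'o list" where
  "quad i j k l X Y x y =
     (\<lambda>m. if m = i then X else if m = j then Y else if m = k then x else if m = l then y else [])"

locale four_agents = fair_mechanism f
  for f :: "('i::finite, 'o::finite) mechanism" +
  fixes i j k l :: 'i and a b c :: 'o
  assumes agents: "distinct [i, j, k, l]" and objects: "distinct [a, b, c]"
begin

abbreviation Q where "Q \<equiv> quad i j k l"

abbreviation P where "P X Y x y m z \<equiv> prob (Q X Y x y) m z"

lemma Q_simps [simp]:
  "Q X Y x y i = X" "Q X Y x y j = Y" "Q X Y x y k = x" "Q X Y x y l = y"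
  using agents by (auto simp: quad_def)

lemma Q_upd:
  "(Q X Y x y)(i := X') = Q X' Y x y" "(Q X Y x y)(k := x') = Q X Y x' y"
  using agents by (auto simp: quad_def)

lemma Q_mirror: "quad j i l k Y X y x = Q X Y x y"
  using agents by (auto simp: quad_def)

lemma P_first:
  "P (z # zs) Y x y i z = P (z # zs') Y x y i z"
  "P X Y (z # zs) y k z = P X Y (z # zs') y k z"
  using prob_first[of "Q [] Y x y" i] prob_first[of "Q X Y [] y" k] by (simp_all add: Q_upd)

lemma sum_P: "(\<Sum>m\<in>UNIV. P X Y x y m z) = P X Y x y i z + P X Y x y j z + P X Y x y k z + P X Y x y l z"
proof -
  have "(\<Sum>m\<in>UNIV. P X Y x y m z) = (\<Sum>m\<in>{i, j, k, l}. P X Y x y m z)"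
    by (intro sum.mono_neutral_right) (auto intro!: prob_unacceptable simp: quad_def)
  then show ?thesis using agents by simp
qed

context
  fixes Y y :: "'o list"
  assumes no_a: "a \<notin> set Y" "a \<notin> set y"
begin

text \<open>Object \<open>a\<close> is certainly assigned, and only \<open>i\<close> and
  \<open>k\<close> can receive it.\<close>

lemma P_a_total:
  assumes "set X = {a, c} \<and> set x = {a, c} \<or> x = [a]"
  shows "P X Y x y i a + P X Y x y k a = 1"
proof -
  have "(\<Sum>m\<in>UNIV. P X Y x y m a) = 1"
    using assms sum_prob_pair[of i k "Q X Y x y" a c] sum_prob_single[of "Q X Y x y" k a] agents
    by auto
  then show ?thesis using no_a by (simp add: sum_P prob_unacceptable)
qed

text \<open>When both report \<open>[a, c]\<close>, equal treatment splits \<open>a\<close> evenly.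
  If \<open>k\<close> drops \<open>c\<close>, its chance of \<open>a\<close> is unchanged, hence so
  is that of \<open>i\<close>.\<close>

lemma P_a_half:
  assumes "x = [a] \<or> x = [a, c]"
  shows "P [a, c] Y x y i a = 1/2"
proof -
  have "P [a, c] Y [a, c] y i a = P [a, c] Y [a, c] y k a"
    by (rule prob_equals) simp
  with P_a_total[of "[a, c]" "[a, c]"] P_a_total[of "[a, c]" "[a]"]
    P_first(2)[of "[a, c]" Y a "[]" y "[c]"] assms
  show ?thesis by auto
qed

text \<open>With \<open>i\<close> out of the contest, \<open>k\<close> surely gets \<open>a\<close>,
  which leaves no probability for \<open>c\<close>.\<close>

lemma P_k_c_eq_0: "P [c] Y [a, c] y k c = 0"
proof -
  have "P [c] Y [a] y k a = 1"
    using P_a_total[of "[c]" "[a]"] objects by (simp add: prob_unacceptable)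
  then have "P [c] Y [a, c] y k a = 1"
    using P_first(2)[of "[c]" Y a "[]" y "[c]"] by simp
  then show ?thesis
    using prob_acceptable_two[of "Q [c] Y [a, c] y" k a c] objects
      assign_prob_nonneg[of f "ranked (Q [c] Y [a, c] y)" k None]
      assign_prob_nonneg[of f "ranked (Q [c] Y [a, c] y)" k "Some c"] by simp
qed

text \<open>Agent \<open>i\<close> passes from \<open>[a, c]\<close> to \<open>[c]\<close> through \<open>[c, a]\<close>, where its chance of \<open>a\<close> is that of
  \<open>k\<close> not getting \<open>a\<close>, on which the report of \<open>c\<close> by \<open>k\<close> has no influence.\<close>

lemma P_c_exchange:
  "P [a, c] Y [a] y i c - P [a, c] Y [a, c] y i c = P [c] Y [a] y i c - P [c] Y [a, c] y i c"
proof -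
  have "P [c, a] Y [a] y i a = P [c, a] Y [a, c] y i a"
    using P_a_total[of "[c, a]" "[a]"] P_a_total[of "[c, a]" "[a, c]"]
      P_first(2)[of "[c, a]" Y a "[]" y "[c]"] by (simp add: insert_commute)
  moreover have "P [a, c] Y x y i a + P [a, c] Y x y i c = P [c, a] Y x y i a + P [c] Y x y i c" for x
    using prob_first_two[of a c "Q [] Y x y" i "[]" "[]"] P_first(1)[of c "[a]" Y x y "[]"] objects
    by (simp add: Q_upd)
  ultimately show ?thesis
    using P_a_half[of "[a]"] P_a_half[of "[a, c]"] by (smt (verit))
qed

end

text \<open>Either someone accepts only \<open>c\<close>, or two agents accept the same pair
  containing \<open>c\<close>.\<close>

lemma P_c_total:
  assumes "X = [c] \<or> Y = [c] \<or> X = [a, c] \<and> x = [a, c] \<or> Y = [b, c] \<and> y = [b, c]"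
  shows "P X Y x y i c + P X Y x y j c + P X Y x y k c + P X Y x y l c = 1"
proof -
  have "(\<Sum>m\<in>UNIV. P X Y x y m c) = 1"
    using assms agents
      sum_prob_single[of "Q X Y x y" i c] sum_prob_single[of "Q X Y x y" j c]
      sum_prob_pair[of i k "Q X Y x y" c a] sum_prob_pair[of j l "Q X Y x y" c b]
    by (auto simp: insert_commute)
  then show ?thesis by (simp add: sum_P)
qed

text \<open>Eliminates the share of \<open>k\<close> in \<open>c\<close> from the linear
  system.\<close>

lemma P_k_c:
  assumes "a \<notin> set Y" "a \<notin> set y"
  shows "P X Y [a] y k c = 0" "P [c] Y [a, c] y k c = 0"
    "P [a, c] Y [a, c] y k c = P [a, c] Y [a, c] y i c"
  using objects assms by (auto intro: prob_unacceptable prob_equals P_k_c_eq_0)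

end

text \<open>Swapping \<open>i\<close> with \<open>j\<close>, \<open>k\<close> with \<open>l\<close>
  and \<open>a\<close> with \<open>b\<close> preserves the setting; \<open>Q_mirror\<close>
  translates the profiles back.\<close>

sublocale four_agents \<subseteq> mirror: four_agents f j i l k b a c
  using agents objects by unfold_locales auto

section \<open>Solving the linear system, and the waste of \<open>c\<close>\<close>

context four_agents
begin

lemma P_target: "P [a, c] [b, c] [a] [b] i c + P [a, c] [b, c] [a] [b] j c = 3/4"
proof -
  have side_i: "P X Y [a] y k c = 0" "P [c] Y [a, c] y k c = 0"
      "P [a, c] Y [a, c] y k c = P [a, c] Y [a, c] y i c"
      "P [a, c] Y [a] y i c - P [a, c] Y [a, c] y i c = P [c] Y [a] y i c - P [c] Y [a, c] y i c"
    if "Y \<in> {[b, c], [c]}" "y \<in> {[b], [b, c]}" for X Y y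
    using that objects by (auto intro!: P_k_c P_c_exchange)
  have side_j: "P X Y x [b] l c = 0" "P X [c] x [b, c] l c = 0"
      "P X [b, c] x [b, c] l c = P X [b, c] x [b, c] j c"
      "P X [b, c] x [b] j c - P X [b, c] x [b, c] j c = P X [c] x [b] j c - P X [c] x [b, c] j c"
    if "X \<in> {[a, c], [c]}" "x \<in> {[a], [a, c]}" for X Y x
    using that objects
    by (auto intro!: mirror.P_k_c[unfolded Q_mirror] mirror.P_c_exchange[unfolded Q_mirror])
  have total_C: "P [c] Y x y i c + P [c] Y x y j c + P [c] Y x y k c + P [c] Y x y l c = 1"
    and total_D: "P X [c] x y i c + P X [c] x y j c + P X [c] x y k c + P X [c] x y l c = 1"
    for X Y x y
    by (simp_all add: P_c_total)
  \<comment> \<open>When \<open>i\<close> reports \<open>[a, c]\<close> and \<open>j\<close> reports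
    \<open>[b, c]\<close>, the totals at the other three reports of \<open>k\<close> and
    \<open>l\<close> give \<open>3/4\<close> plus a correction. The exchange identities turn it into
    mixed differences, over the reports of \<open>k\<close> and \<open>l\<close>, of the shares of
    \<open>i\<close> and \<open>j\<close> when both report \<open>[c]\<close>. There the two shares
    sum to 1, so the differences cancel.\<close>
  show ?thesis
    using P_c_total[of "[a, c]" "[b, c]" "[a, c]" "[b, c]"]
      P_c_total[of "[a, c]" "[b, c]" "[a, c]" "[b]"] P_c_total[of "[a, c]" "[b, c]" "[a]" "[b, c]"]
      total_C[of "[b, c]" "[a]" "[b]"] total_C[of "[b, c]" "[a]" "[b, c]"]
      total_C[of "[b, c]" "[a, c]" "[b]"] total_C[of "[b, c]" "[a, c]" "[b, c]"]
      total_C[of "[c]" "[a]" "[b]"] total_C[of "[c]" "[a]" "[b, c]"]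
      total_C[of "[c]" "[a, c]" "[b]"] total_C[of "[c]" "[a, c]" "[b, c]"]
      total_D[of "[a, c]" "[a]" "[b]"] total_D[of "[a, c]" "[a]" "[b, c]"]
      total_D[of "[a, c]" "[a, c]" "[b]"] total_D[of "[a, c]" "[a, c]" "[b, c]"]
      side_i(4)[of "[b, c]" "[b]"] side_i(4)[of "[b, c]" "[b, c]"]
      side_i(4)[of "[c]" "[b]"] side_i(4)[of "[c]" "[b, c]"]
      side_j(4)[of "[a, c]" "[a]"] side_j(4)[of "[a, c]" "[a, c]"]
      side_j(4)[of "[c]" "[a]"] side_j(4)[of "[c]" "[a, c]"]
    by (simp add: side_i(1-3) side_j(1-3))
qed

lemma object_wasteful_quarter: "object_wasteful (1/4) f"
proof -
  let ?L = "Q [a, c] [b, c] [a] [b]"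
  have obj: "a \<noteq> c" "b \<noteq> c" "a \<noteq> b" using objects by auto
  have "{m. strictly_prefers (ranked ?L m) (Some c) None} = {i, j}"
    using objects by (auto simp: ranked_def strictly_prefers_ranking_None quad_def)
  moreover have "i \<noteq> j" using agents by simp
  moreover have "prob ?L i a = 1/2" "prob ?L j b = 1/2"
    using P_a_half[of "[b, c]" "[b]" "[a]"] mirror.P_a_half[of "[a, c]" "[a]" "[b]"] obj
    by (auto simp: Q_mirror)
  \<comment> \<open>Agents \<open>i\<close> and \<open>j\<close> are unassigned with total
    probability \<open>2 - 1/2 - 1/2 - 3/4\<close>.\<close>
  ultimately have "(\<Sum>m | strictly_prefers (ranked ?L m) (Some c) None. assign_prob f (ranked ?L) m None) = 1/4"
    using P_target prob_acceptable_two[of ?L i a c] prob_acceptable_two[of ?L j b c] obj by simp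
  moreover have "unassigned_prob f (ranked ?L) c = 1/4"
    using P_target obj by (simp add: unassigned_prob_def sum_P prob_unacceptable)
  ultimately show ?thesis
    unfolding object_wasteful_def by (intro exI[of _ "ranked ?L"] exI[of _ c]) (simp add: is_profile_ranked)
qed

end

section \<open>Choice of the agents and objects, and the two claims\<close>

lemma ex_distinct_list_of_length:
  assumes "n \<le> CARD('a::finite)"
  shows "\<exists>xs :: 'a list. distinct xs \<and> length xs = n"
proof -
  obtain A :: "'a set" where A: "card A = n"
    using obtain_subset_with_card_n[OF assms] by blast
  obtain xs where "set xs = A" "distinct xs"
    using finite_distinct_list[of A] by auto
  then show ?thesis using A by (auto simp: distinct_card)
qed

lemma (in fair_mechanism) object_wasteful_quarter:
  assumes "CARD('i) \<ge> 4" "CARD('o) \<ge> 3"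
  shows "object_wasteful (1/4) f"
proof -
  obtain Is :: "'i list" and Js :: "'o list"
    where "distinct Is" "length Is = 4" "distinct Js" "length Js = 3"
    using ex_distinct_list_of_length[OF assms(1)] ex_distinct_list_of_length[OF assms(2)] by blast
  then obtain i j k l a b c where "distinct [i, j, k, l :: 'i]" "distinct [a, b, c :: 'o]"
    by (auto simp: numeral_eq_Suc length_Suc_conv)
  then interpret four_agents f i j k l a b c by unfold_locales
  show ?thesis by (rule object_wasteful_quarter)
qed

theorem theorem2:
  fixes f :: "('i::finite, 'o::finite) mechanism"
  assumes "CARD('i) \<ge> 4" and "CARD('o) \<ge> 3"
    and "is_mechanism f"
  shows "(equal_treatment_of_almost_equals f \<and> strategy_proof f \<and> ex_post_weakly_nonwasteful f
            \<longrightarrow> (\<exists>q\<in>{0..1}. q \<ge> 1/4 \<and> object_wasteful q f))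
       \<and> (equal_treatment_of_equals f \<and> strategy_proof f \<and> ex_post_efficient f
            \<longrightarrow> (\<exists>q\<in>{0..1}. q \<ge> 1/4 \<and> object_wasteful q f))"
proof (intro conjI impI)
  assume "equal_treatment_of_almost_equals f \<and> strategy_proof f \<and> ex_post_weakly_nonwasteful f"
  then interpret fair_mechanism f
    using assms(3) by unfold_locales (auto intro: equal_treatment_of_equals_if_almost_equals)
  show "\<exists>q\<in>{0..1}. q \<ge> 1/4 \<and> object_wasteful q f"
    using object_wasteful_quarter[OF assms(1,2)] by (intro bexI[of _ "1/4"]) auto
next
  assume "equal_treatment_of_equals f \<and> strategy_proof f \<and> ex_post_efficient f"
  moreover from this have "ex_post_weakly_nonwasteful f"
    using assms(3) efficient_imp_weakly_nonwasteful
    unfolding ex_post_weakly_nonwasteful_def ex_post_efficient_def is_mechanism_def by blast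
  ultimately interpret fair_mechanism f
    using assms(3) by unfold_locales auto
  show "\<exists>q\<in>{0..1}. q \<ge> 1/4 \<and> object_wasteful q f"
    using object_wasteful_quarter[OF assms(1,2)] by (intro bexI[of _ "1/4"]) auto
qed

end
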